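(* Let $T$ be a free tree with vertex set $V$. Then a planar arrangement of $T$ of maximum cost is also a projective arrangement of maximum cost of $T$ rooted at some vertex $u\in V$, and $$D^{\mathrm{pl}}_{\max}(T)=\max_{u\in V} D^{\mathrm{pr}}_{\max}(T^u).$$
   Context: A linear arrangement of a graph $G=(V,E)$ with $n=|V|$ is a bijection $\pi:V\to\{1,\dots,n\}$; the cost of $\pi$ is $\sum_{uv\in E}|\pi(u)-\pi(v)|$. Two edges $st,uv$ with $\pi(s)<\pi(t)$, $\pi(u)<\pi(v)$, $\pi(s)<\pi(u)$ cross if $\pi(s)<\pi(u)<\pi(t)<\pi(v)$; an arrangement is planar if no two edges cross. $D^{\mathrm{pl}}_{\max}(T)$ is the maximum cost over all planar arrangements of the free tree $T$. For $u\in V$, $T^u$ denotes $T$ rooted at $u$; an arrangement of $T^u$ is projective if it is planar and there is no edge $xy$ with $\min(\pi(x),\pi(y))<\pi(u)<\max(\pi(x),\pi(y))$, and $D^{\mathrm{pr}}_{\max}(T^u)$ is the maximum cost over all projective arrangements of $T^u$. *)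

theory Defs
  imports Main
begin

definition simple_graph :: "'a set \<Rightarrow> 'a set set \<Rightarrow> bool" where
  "simple_graph V E \<longleftrightarrow> finite V \<and> (\<forall>e\<in>E. \<exists>u\<in>V. \<exists>v\<in>V. u \<noteq> v \<and> e = {u, v})"

definition graph_connected :: "'a set \<Rightarrow> 'a set set \<Rightarrow> bool" where
  "graph_connected V E \<longleftrightarrow> V \<noteq> {} \<and> (\<forall>u\<in>V. \<forall>v\<in>V. (u, v) \<in> {(x, y). {x, y} \<in> E}\<^sup>*)"

definition graph_cycle :: "'a set set \<Rightarrow> 'a list \<Rightarrow> bool" where
  "graph_cycle E xs \<longleftrightarrow> 3 \<le> length xs \<and> distinct xs \<and>
     successively (\<lambda>x y. {x, y} \<in> E) xs \<and> {last xs, hd xs} \<in> E"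

definition free_tree :: "'a set \<Rightarrow> 'a set set \<Rightarrow> bool" where
  "free_tree V E \<longleftrightarrow> simple_graph V E \<and> graph_connected V E \<and> (\<nexists>xs. graph_cycle E xs)"

text \<open>Only the values of an arrangement on \<open>V\<close> are relevant.\<close>

definition linear_arrangement :: "'a set \<Rightarrow> ('a \<Rightarrow> nat) \<Rightarrow> bool" where
  "linear_arrangement V \<pi> \<longleftrightarrow> bij_betw \<pi> V {1..card V}"

text \<open>The description is well defined because the length is symmetric in the two
  endpoints; see \<open>edge_length_doubleton\<close>.\<close>

definition edge_length :: "('a \<Rightarrow> nat) \<Rightarrow> 'a set \<Rightarrow> int" where
  "edge_length \<pi> e = (THE d. \<exists>u v. e = {u, v} \<and> d = \<bar>int (\<pi> u) - int (\<pi> v)\<bar>)"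

lemma edge_length_doubleton [simp]:
  "edge_length \<pi> {u, v} = \<bar>int (\<pi> u) - int (\<pi> v)\<bar>"
  unfolding edge_length_def by (rule the_equality) (auto simp: doubleton_eq_iff)

definition arrangement_cost :: "'a set set \<Rightarrow> ('a \<Rightarrow> nat) \<Rightarrow> int" where
  "arrangement_cost E \<pi> = (\<Sum>e\<in>E. edge_length \<pi> e)"

definition edges_cross :: "('a \<Rightarrow> nat) \<Rightarrow> 'a \<Rightarrow> 'a \<Rightarrow> 'a \<Rightarrow> 'a \<Rightarrow> bool" where
  "edges_cross \<pi> s t u v \<longleftrightarrow> \<pi> s < \<pi> u \<and> \<pi> u < \<pi> t \<and> \<pi> t < \<pi> v"

definition planar_arrangement :: "'a set \<Rightarrow> 'a set set \<Rightarrow> ('a \<Rightarrow> nat) \<Rightarrow> bool" where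
  "planar_arrangement V E \<pi> \<longleftrightarrow> linear_arrangement V \<pi> \<and>
     \<not> (\<exists>s t u v. {s, t} \<in> E \<and> {u, v} \<in> E \<and> edges_cross \<pi> s t u v)"

text \<open>The rooted tree $T^r$ is given by \<open>V\<close>, \<open>E\<close> and the root \<open>r\<close>.\<close>

definition projective_arrangement :: "'a set \<Rightarrow> 'a set set \<Rightarrow> 'a \<Rightarrow> ('a \<Rightarrow> nat) \<Rightarrow> bool" where
  "projective_arrangement V E r \<pi> \<longleftrightarrow> planar_arrangement V E \<pi> \<and>
     \<not> (\<exists>x y. {x, y} \<in> E \<and> min (\<pi> x) (\<pi> y) < \<pi> r \<and> \<pi> r < max (\<pi> x) (\<pi> y))"

definition D_pl_max :: "'a set \<Rightarrow> 'a set set \<Rightarrow> int" where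
  "D_pl_max V E = Max {arrangement_cost E \<pi> | \<pi>. planar_arrangement V E \<pi>}"

definition D_pr_max :: "'a set \<Rightarrow> 'a set set \<Rightarrow> 'a \<Rightarrow> int" where
  "D_pr_max V E r = Max {arrangement_cost E \<pi> | \<pi>. projective_arrangement V E r \<pi>}"

end

theory Submission
  imports Defs
begin

text \<open>No edge can cover the leftmost vertex of an arrangement, so every planar arrangement is
  projective for the tree rooted at that vertex. For the equality of the two maxima one also needs
  that every rooting admits a projective arrangement: grow a subtree from the root, inserting each
  new vertex immediately to the right of its unique neighbour in the current subtree. The new edge
  joins consecutive positions and hence crosses nothing, and the root stays leftmost.\<close>

section \<open>Simple paths and boundary edges\<close>

text \<open>The clauses mirror those of \<open>graph_cycle\<close>, so that prepending a vertex
  adjacent to both ends turns such a path into a cycle.\<close>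

definition path_in :: "'a set set \<Rightarrow> 'a set \<Rightarrow> 'a \<Rightarrow> 'a \<Rightarrow> 'a list \<Rightarrow> bool" where
  "path_in E W a b xs \<longleftrightarrow> xs \<noteq> [] \<and> distinct xs \<and> set xs \<subseteq> W \<and>
     successively (\<lambda>x y. {x, y} \<in> E) xs \<and> hd xs = a \<and> last xs = b"

lemma path_in_mono: "path_in E W a b xs \<Longrightarrow> W \<subseteq> W' \<Longrightarrow> path_in E W' a b xs"
  unfolding path_in_def by auto

lemma path_in_Cons:
  assumes "path_in E W a b xs" "{y, a} \<in> E" "y \<notin> W"
  shows "path_in E (insert y W) y b (y # xs)"
  using assms unfolding path_in_def by (auto simp: successively_Cons)

lemma path_in_snoc:
  assumes "path_in E W a b xs" "{b, y} \<in> E" "y \<notin> W"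
  shows "path_in E (insert y W) a y (xs @ [y])"
  using assms unfolding path_in_def by (auto simp: successively_append_iff)

text \<open>Otherwise the path between the two neighbours, which avoids \<open>y\<close>, would
  close up through \<open>y\<close> to a cycle.\<close>

lemma acyclic_unique_neighbour:
  assumes acyclic: "\<nexists>xs. graph_cycle E xs"
    and path: "path_in E W x x' xs"
    and "y \<notin> W" "{x, y} \<in> E" "{x', y} \<in> E"
  shows "x' = x"
proof (rule ccontr)
  assume "x' \<noteq> x"
  \<comment> \<open>The ends of the path differ, so with \<open>y\<close> in front the list reaches
    the length 3 demanded of a cycle.\<close>
  have "2 \<le> length xs"
  proof (cases xs)
    case Nil
    then show ?thesis using path by (simp add: path_in_def)
  next
    case (Cons z zs)
    then show ?thesis using path \<open>x' \<noteq> x\<close> by (cases zs) (auto simp: path_in_def)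
  qed
  then have "graph_cycle E (y # xs)"
    using path assms(3-) unfolding graph_cycle_def path_in_def
    by (auto simp: successively_Cons insert_commute)
  then show False using acyclic by blast
qed

text \<open>A walk from \<open>r\<close> to a vertex outside \<open>W\<close> must leave
  \<open>W\<close> at some step.\<close>

lemma connected_boundary_edge:
  assumes "graph_connected V E" "W \<subset> V" "r \<in> W"
  obtains x y where "x \<in> W" "y \<notin> W" "{x, y} \<in> E"
proof -
  obtain v where v: "v \<in> V" "v \<notin> W" using assms(2) by blast
  have "(r, v) \<in> {(x, y). {x, y} \<in> E}\<^sup>*"
    using assms v unfolding graph_connected_def by blast
  \<comment> \<open>Invariant along the walk: it is still inside \<open>W\<close>, or an edge
    leaving \<open>W\<close> has been found.\<close>
  then have "v \<in> W \<or> (\<exists>x y. x \<in> W \<and> y \<notin> W \<and> {x, y} \<in> E)"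
    by (induction rule: rtrancl_induct) (use assms(3) in auto)
  then show ?thesis using v that by blast
qed

section \<open>Inserting a vertex next to its neighbour\<close>

text \<open>The case \<open>v = y\<close> comes first because \<open>\<pi> y\<close> is arbitrary
  while \<open>y\<close> lies outside the arranged set.\<close>

definition insert_after :: "('a \<Rightarrow> nat) \<Rightarrow> 'a \<Rightarrow> 'a \<Rightarrow> 'a \<Rightarrow> nat" where
  "insert_after \<pi> x y v =
     (if v = y then Suc (\<pi> x) else if \<pi> v \<le> \<pi> x then \<pi> v else Suc (\<pi> v))"

lemma linear_arrangement_insert_after:
  assumes "finite W" "linear_arrangement W \<pi>" "x \<in> W" "y \<notin> W"
  shows "linear_arrangement (insert y W) (insert_after \<pi> x y)"
proof -
  let ?\<rho> = "insert_after \<pi> x y"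
  have inj: "inj_on \<pi> W" and img: "\<pi> ` W = {1..card W}"
    using assms(2) unfolding linear_arrangement_def bij_betw_def by auto
  \<comment> \<open>Old vertices keep values up to \<open>\<pi> x\<close> or move to values from
    \<open>\<pi> x + 2\<close> on; the gap is left for \<open>y\<close>.\<close>
  have inj': "inj_on ?\<rho> (insert y W)"
    using inj assms(4) unfolding inj_on_def insert_after_def by auto
  have card: "card (insert y W) = Suc (card W)" using assms by simp
  have range: "1 \<le> \<pi> v \<and> \<pi> v \<le> card W" if "v \<in> W" for v
    using img that by (metis atLeastAtMost_iff imageI)
  \<comment> \<open>Inclusion suffices: by injectivity both sides have the same finite
    cardinality.\<close>
  have "?\<rho> ` insert y W \<subseteq> {1..card (insert y W)}"
    unfolding card using range assms(3) by (fastforce simp: insert_after_def)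
  then have "?\<rho> ` insert y W = {1..card (insert y W)}"
    using card_image[OF inj'] by (intro card_subset_eq) (simp_all del: image_insert)
  then show ?thesis using inj' unfolding linear_arrangement_def bij_betw_def by blast
qed

text \<open>The relative order on \<open>W\<close> is preserved, so old edges still do not cross,
  and nothing fits strictly between the two ends of the new edge.\<close>

lemma planar_arrangement_insert_after:
  assumes "finite W" and planar: "planar_arrangement W F \<pi>" and "x \<in> W" "y \<notin> W"
    and F: "\<And>e. e \<in> F \<Longrightarrow> e \<subseteq> W"
  shows "planar_arrangement (insert y W) (insert {x, y} F) (insert_after \<pi> x y)"
proof -
  let ?\<rho> = "insert_after \<pi> x y"
  have less: "?\<rho> a < ?\<rho> b \<longleftrightarrow> \<pi> a < \<pi> b" if "a \<in> W" "b \<in> W" for a b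
    using that \<open>y \<notin> W\<close> unfolding insert_after_def by auto
  have consecutive: "?\<rho> y = Suc (?\<rho> x)"
    using assms(3,4) by (auto simp: insert_after_def)
  have "\<not> edges_cross ?\<rho> s t u v"
    if st: "{s, t} \<in> insert {x, y} F" and uv: "{u, v} \<in> insert {x, y} F" for s t u v
  \<comment> \<open>A crossing places \<open>u\<close> strictly inside the span of \<open>st\<close>
    and \<open>t\<close> strictly inside that of \<open>uv\<close>; it is impossible if either edge
    has length 1.\<close>
  proof (cases "{s, t} = {x, y} \<or> {u, v} = {x, y}")
    case True
    then show ?thesis using consecutive
      by (auto simp: edges_cross_def doubleton_eq_iff)
  next
    case False
    then have "{s, t} \<in> F" "{u, v} \<in> F" using st uv by auto
    moreover from this have "s \<in> W" "t \<in> W" "u \<in> W" "v \<in> W" using F by blast+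
    ultimately show ?thesis using planar less
      unfolding planar_arrangement_def edges_cross_def by blast
  qed
  moreover have "linear_arrangement (insert y W) ?\<rho>"
    using planar assms(1,3,4) unfolding planar_arrangement_def
    by (intro linear_arrangement_insert_after) auto
  ultimately show ?thesis unfolding planar_arrangement_def by blast
qed

lemma simple_graph_edge_subset:
  assumes "simple_graph V E" "e \<in> E"
  shows "e \<subseteq> V"
proof -
  obtain u v where "u \<in> V" "v \<in> V" "e = {u, v}"
    using assms unfolding simple_graph_def by blast
  then show ?thesis by simp
qed

section \<open>Growing a subtree from the root\<close>

text \<open>Induction on the size of the subtree. Connectedness of \<open>W\<close> is carried along
  because it forces the next vertex to have only one neighbour in \<open>W\<close>;
  \<open>\<pi> r = 1\<close> keeps the root leftmost.\<close>

lemma rooted_subtree_planar_arrangement: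
  assumes tree: "free_tree V E" and "r \<in> V"
    and "1 \<le> k" "k \<le> card V"
  shows "\<exists>W \<pi>. r \<in> W \<and> W \<subseteq> V \<and> card W = k \<and>
           (\<forall>a\<in>W. \<forall>b\<in>W. \<exists>xs. path_in E W a b xs) \<and>
           planar_arrangement W {e \<in> E. e \<subseteq> W} \<pi> \<and> \<pi> r = 1"
  using assms(3,4)
proof (induction k rule: dec_induct)
  case base
  have "\<exists>xs. path_in E {r} r r xs"
    by (rule exI[of _ "[r]"]) (simp add: path_in_def)
  moreover have "planar_arrangement {r} {e \<in> E. e \<subseteq> {r}} (\<lambda>_. 1)"
    by (auto simp: planar_arrangement_def linear_arrangement_def edges_cross_def bij_betw_def)
  ultimately show ?case using \<open>r \<in> V\<close>
    by (intro exI[of _ "{r}"] exI[of _ "\<lambda>_. 1"]) auto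
next
  case (step k)
  have simple: "simple_graph V E" and connected: "graph_connected V E"
    and acyclic: "\<nexists>xs. graph_cycle E xs"
    using tree unfolding free_tree_def by auto
  have "finite V" using simple unfolding simple_graph_def by blast
  from step obtain W \<pi> where r: "r \<in> W" and sub: "W \<subseteq> V" and card: "card W = k"
    and path: "\<And>a b. a \<in> W \<Longrightarrow> b \<in> W \<Longrightarrow> \<exists>xs. path_in E W a b xs"
    and planar: "planar_arrangement W {e \<in> E. e \<subseteq> W} \<pi>" and "\<pi> r = 1"
    by auto
  have fin: "finite W" using sub \<open>finite V\<close> finite_subset by blast
  have "W \<subset> V" using sub card step.prems by auto
  then obtain x y where x: "x \<in> W" and y: "y \<notin> W" and xy: "{x, y} \<in> E"
    using connected_boundary_edge[OF connected _ r] by blast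
  have "y \<in> V" using simple_graph_edge_subset[OF simple xy] by simp
  let ?W = "insert y W" and ?\<rho> = "insert_after \<pi> x y"
  \<comment> \<open>A second new edge would join \<open>y\<close> to another vertex
    \<open>x'\<close> of \<open>W\<close>, and a path from \<open>x\<close> to \<open>x'\<close>
    inside \<open>W\<close> excludes this.\<close>
  have edges: "{e \<in> E. e \<subseteq> ?W} = insert {x, y} {e \<in> E. e \<subseteq> W}"
  proof -
    have "e = {x, y}" if e: "e \<in> E" "e \<subseteq> ?W" "\<not> e \<subseteq> W" for e
    proof -
      obtain a b where ab: "a \<noteq> b" "e = {a, b}"
        using simple e(1) unfolding simple_graph_def by blast
      then obtain x' where x': "x' \<in> W" "e = {x', y}" using e by blast
      obtain xs where "path_in E W x x' xs" using path x x'(1) by blast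
      then have "x' = x" using acyclic_unique_neighbour[OF acyclic] y xy e(1) x'(2) by blast
      then show ?thesis using x' by simp
    qed
    then have "{e \<in> E. e \<subseteq> ?W} \<subseteq> insert {x, y} {e \<in> E. e \<subseteq> W}" by blast
    moreover have "{x, y} \<subseteq> ?W" using x by blast
    ultimately show ?thesis using xy by blast
  qed
  have "planar_arrangement ?W {e \<in> E. e \<subseteq> ?W} ?\<rho>"
    unfolding edges using fin planar x y by (intro planar_arrangement_insert_after) auto
  moreover have "?\<rho> r = 1"
  proof -
    \<comment> \<open>Hence \<open>\<pi> r = 1 \<le> \<pi> x\<close>, so the insertion leaves the
      root in place, even when \<open>x = r\<close>.\<close>
    have "\<pi> x \<in> {1..card W}"
      using planar x unfolding planar_arrangement_def linear_arrangement_def bij_betw_def by blast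
    then show ?thesis using r y \<open>\<pi> r = 1\<close> by (auto simp: insert_after_def)
  qed
  moreover have "\<exists>xs. path_in E ?W a b xs" if a: "a \<in> ?W" and b: "b \<in> ?W" for a b
  proof -
    have yx: "{y, x} \<in> E" using xy by (simp add: insert_commute)
    consider "a \<in> W" "b \<in> W" | "a \<in> W" "b = y" | "a = y" "b \<in> W" | "a = y" "b = y"
      using a b by blast
    then show ?thesis
    proof cases
      case 1
      then show ?thesis using path path_in_mono by (metis subset_insertI)
    next
      case 2
      then show ?thesis using path x path_in_snoc[OF _ xy y] by blast
    next
      case 3
      then show ?thesis using path x path_in_Cons[OF _ yx y] by blast
    next
      case 4
      then have "path_in E ?W a b [y]" by (simp add: path_in_def)
      then show ?thesis by blast
    qed
  qed
  moreover have "card ?W = Suc k" using fin y card by simp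
  moreover have "r \<in> ?W" "?W \<subseteq> V" using r sub \<open>y \<in> V\<close> by auto
  ultimately show ?case by blast
qed

section \<open>Projectivity and existence\<close>

lemma leftmost_projective:
  assumes simple: "simple_graph V E" and planar: "planar_arrangement V E \<pi>" and "\<pi> r = 1"
  shows "projective_arrangement V E r \<pi>"
proof -
  \<comment> \<open>Positions start at 1, so already the left half of the covering condition
    fails.\<close>
  have "\<not> min (\<pi> x) (\<pi> y) < \<pi> r" if "{x, y} \<in> E" for x y
  proof -
    have "x \<in> V" "y \<in> V" using simple_graph_edge_subset[OF simple that] by auto
    then have "\<pi> x \<in> {1..card V}" "\<pi> y \<in> {1..card V}"
      using planar unfolding planar_arrangement_def linear_arrangement_def bij_betw_def by blast+
    then show ?thesis using \<open>\<pi> r = 1\<close> by auto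
  qed
  then show ?thesis using planar unfolding projective_arrangement_def by blast
qed

text \<open>Needed so that the maxima range over nonempty sets, since \<open>Max\<close> of the
  empty set says nothing.\<close>

lemma free_tree_projective_arrangement_exists:
  assumes tree: "free_tree V E" and "r \<in> V"
  shows "\<exists>\<pi>. projective_arrangement V E r \<pi>"
proof -
  have simple: "simple_graph V E" using tree unfolding free_tree_def by blast
  then have "finite V" unfolding simple_graph_def by blast
  then have "1 \<le> card V" using \<open>r \<in> V\<close> by (metis One_nat_def Suc_leI card_gt_0_iff empty_iff)
  then obtain W \<pi> where W: "W \<subseteq> V" "card W = card V"
    and planar: "planar_arrangement W {e \<in> E. e \<subseteq> W} \<pi>" and "\<pi> r = 1"
    using rooted_subtree_planar_arrangement[OF assms, of "card V"] by auto
  have "W = V" using W \<open>finite V\<close> card_subset_eq by blast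
  moreover have "{e \<in> E. e \<subseteq> V} = E" using simple_graph_edge_subset[OF simple] by blast
  ultimately have "planar_arrangement V E \<pi>" using planar by simp
  then show ?thesis using leftmost_projective[OF simple] \<open>\<pi> r = 1\<close> by blast
qed

lemma planar_projective_at_leftmost:
  assumes simple: "simple_graph V E" and "V \<noteq> {}" and planar: "planar_arrangement V E \<pi>"
  obtains u where "u \<in> V" "projective_arrangement V E u \<pi>"
proof -
  have "finite V" using simple unfolding simple_graph_def by blast
  then have "1 \<in> {1..card V}" using \<open>V \<noteq> {}\<close> by (simp add: Suc_leI card_gt_0_iff)
  then obtain u where "u \<in> V" "\<pi> u = 1"
    using planar unfolding planar_arrangement_def linear_arrangement_def bij_betw_def
    by (metis imageE)
  then show ?thesis using that leftmost_projective[OF simple planar] by blast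
qed

section \<open>Comparing the maxima\<close>

text \<open>Arrangements are functions with arbitrary values off \<open>V\<close>, so there may be
  infinitely many of them; finiteness comes instead from bounding their integer costs.\<close>

lemma finite_planar_costs:
  assumes simple: "simple_graph V E"
  shows "finite {arrangement_cost E \<pi> | \<pi>. planar_arrangement V E \<pi>}"
proof (rule finite_subset)
  show "finite {0..int (card E) * int (card V)}" by simp
  have "arrangement_cost E \<pi> \<in> {0..int (card E) * int (card V)}"
    if planar: "planar_arrangement V E \<pi>" for \<pi>
  proof -
    have bounds: "0 \<le> edge_length \<pi> e \<and> edge_length \<pi> e \<le> int (card V)" if e: "e \<in> E" for e
    proof -
      obtain u v where uv: "u \<in> V" "v \<in> V" "e = {u, v}"
        using simple e unfolding simple_graph_def by blast
      then have "\<pi> u \<in> {1..card V}" "\<pi> v \<in> {1..card V}"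
        using planar unfolding planar_arrangement_def linear_arrangement_def bij_betw_def by blast+
      then show ?thesis using uv by auto
    qed
    then show ?thesis unfolding arrangement_cost_def
      using sum_bounded_above[of E "edge_length \<pi>" "int (card V)"] by (auto intro: sum_nonneg)
  qed
  then show "{arrangement_cost E \<pi> | \<pi>. planar_arrangement V E \<pi>}
      \<subseteq> {0..int (card E) * int (card V)}" by blast
qed

theorem theorem2:
  fixes V :: "'a set" and E :: "'a set set"
  assumes "free_tree V E"
  shows "(\<forall>\<pi>. is_arg_max (arrangement_cost E) (planar_arrangement V E) \<pi> \<longrightarrow>
            (\<exists>u\<in>V. is_arg_max (arrangement_cost E) (projective_arrangement V E u) \<pi>))
       \<and> D_pl_max V E = (MAX u\<in>V. D_pr_max V E u)"
proof -
  have simple: "simple_graph V E" and "V \<noteq> {}"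
    using assms unfolding free_tree_def graph_connected_def by auto
  then have "finite V" unfolding simple_graph_def by blast
  have projD: "planar_arrangement V E \<pi>" if "projective_arrangement V E u \<pi>" for u \<pi>
    using that unfolding projective_arrangement_def by blast
  let ?pl = "{arrangement_cost E \<pi> | \<pi>. planar_arrangement V E \<pi>}"
  let ?pr = "\<lambda>u. {arrangement_cost E \<pi> | \<pi>. projective_arrangement V E u \<pi>}"
  have fin_pl: "finite ?pl" by (rule finite_planar_costs[OF simple])
  have sub: "?pr u \<subseteq> ?pl" for u using projD by blast
  have fin_pr: "finite (?pr u)" for u using finite_subset[OF sub fin_pl] .
  have ne_pr: "?pr u \<noteq> {}" if "u \<in> V" for u
    using free_tree_projective_arrangement_exists[OF assms that] by blast
  then have ne_pl: "?pl \<noteq> {}" using sub \<open>V \<noteq> {}\<close> by blast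
  \<comment> \<open>An optimal planar arrangement competes in the projective maximum at its leftmost
    vertex.\<close>
  have "D_pl_max V E \<le> (MAX u\<in>V. D_pr_max V E u)"
  proof -
    obtain \<pi> where \<pi>: "planar_arrangement V E \<pi>" "D_pl_max V E = arrangement_cost E \<pi>"
      using Max_in[OF fin_pl ne_pl] unfolding D_pl_max_def by blast
    obtain u where u: "u \<in> V" "projective_arrangement V E u \<pi>"
      using planar_projective_at_leftmost[OF simple \<open>V \<noteq> {}\<close> \<pi>(1)] .
    have "arrangement_cost E \<pi> \<le> D_pr_max V E u"
      unfolding D_pr_max_def using u by (intro Max_ge fin_pr) blast
    also have "\<dots> \<le> (MAX u\<in>V. D_pr_max V E u)" using u \<open>finite V\<close> by simp
    finally show ?thesis using \<pi>(2) by simp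
  qed
  moreover have "(MAX u\<in>V. D_pr_max V E u) \<le> D_pl_max V E"
    using \<open>finite V\<close> \<open>V \<noteq> {}\<close> Max_mono[OF sub ne_pr fin_pl]
    unfolding D_pl_max_def D_pr_max_def by simp
  \<comment> \<open>The leftmost vertex serves as \<open>u\<close>: a better projective arrangement
    would also be a better planar one.\<close>
  moreover have "\<exists>u\<in>V. is_arg_max (arrangement_cost E) (projective_arrangement V E u) \<pi>"
    if "is_arg_max (arrangement_cost E) (planar_arrangement V E) \<pi>" for \<pi>
    using that planar_projective_at_leftmost[OF simple \<open>V \<noteq> {}\<close>, of \<pi>] projD
    unfolding is_arg_max_def by metis
  ultimately show ?thesis by auto
qed

end
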